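(* Let $C$ be a bounded convex subset of a Banach space $X$, let $\mathcal U$ be a free ultrafilter on an infinite set $I$, and let $\{x_i\}_{i\in I}\subset C$ be a uniformly denting set in $C$. Then $(x_i)_{\mathcal U}$ is an $(X^* )_{\mathcal U}$-denting point of $C_{\mathcal U}$.
   Context: Banach spaces are real; $S_{X^*}$ is the unit sphere of $X^*$. A free ultrafilter is a non-principal ultrafilter. The ultrapower is $X_{\mathcal U}=\ell_\infty(I,X)/\{(x_i)_{i\in I}:\lim_{\mathcal U}\|x_i\|=0\}$; the class of $(x_i)_{i\in I}$ is written $(x_i)_{\mathcal U}$ and has norm $\lim_{\mathcal U}\|x_i\|$. For bounded $A\subset X$, $A_{\mathcal U}=\{(x_i)_{\mathcal U}: x_i\in A\ \forall i\in I\}$. $(X^* )_{\mathcal U}$ is regarded as a subspace of $(X_{\mathcal U})^*$ through $\langle (x_i^* )_{\mathcal U},(x_i)_{\mathcal U}\rangle=\lim_{\mathcal U}x_i^*(x_i)$. For a bounded convex set $D$ in a Banach space $Y$, $y^*\in Y^*$ and $\alpha>0$, the slice is $S(D,y^*,\alpha)=\{y\in D: y^*(y)>\sup_D y^*-\alpha\}$. For a subspace $Z\subset Y^*$, a point $y\in D$ is $Z$-denting if for every $\varepsilon>0$ there are $y^*\in Z$ and $\alpha>0$ with $y\in S(D,y^*,\alpha)$ and $\operatorname{diam}S(D,y^*,\alpha)<\varepsilon$. A set $\{x_i\}_{i\in I}\subset C$ is uniformly denting if for every $\varepsilon>0$ there is $\alpha_\varepsilon>0$ such that for every $i\in I$ there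 is $x_i^*\in S_{X^*}$ with $x_i\in S(C,x_i^*,\alpha_\varepsilon)$ and $\operatorname{diam}S(C,x_i^*,\alpha_\varepsilon)<\varepsilon$. *)

theory Defs
  imports "HOL-Analysis.Analysis"
begin

section \<open>Free ultrafilters\<close>

definition ultrafilter :: "'i filter \<Rightarrow> bool" where
  "ultrafilter U \<longleftrightarrow> U \<noteq> bot \<and> (\<forall>P. eventually P U \<or> eventually (\<lambda>i. \<not> P i) U)"

definition free_ultrafilter :: "'i filter \<Rightarrow> bool" where
  "free_ultrafilter U \<longleftrightarrow> ultrafilter U \<and> (\<forall>i. U \<noteq> principal {i})"

section \<open>The ultrapower of a normed space\<close>

text \<open>HOL has no type depending on the filter \<open>U\<close>, so the ultrapower is a set of equivalence
  classes of bounded families; its operations and its norm are given through representatives.\<close>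

definition linfty :: "('i \<Rightarrow> 'a::real_normed_vector) set" where
  "linfty = {f. bounded (range f)}"

definition upower_rel :: "'i filter \<Rightarrow> (('i \<Rightarrow> 'a::real_normed_vector) \<times> ('i \<Rightarrow> 'a)) set" where
  "upower_rel U = {(f, g). f \<in> linfty \<and> g \<in> linfty \<and> ((\<lambda>i. norm (f i - g i)) \<longlongrightarrow> 0) U}"

definition upower :: "'i filter \<Rightarrow> ('i \<Rightarrow> 'a::real_normed_vector) set set" where
  "upower U = linfty // upower_rel U"

definition upower_class :: "'i filter \<Rightarrow> ('i \<Rightarrow> 'a::real_normed_vector) \<Rightarrow> ('i \<Rightarrow> 'a) set" where
  "upower_class U f = upower_rel U `` {f}"

definition upower_rep :: "('i \<Rightarrow> 'a) set \<Rightarrow> 'i \<Rightarrow> 'a" where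
  "upower_rep A = (SOME f. f \<in> A)"

definition upower_add ::
  "'i filter \<Rightarrow> ('i \<Rightarrow> 'a::real_normed_vector) set \<Rightarrow> ('i \<Rightarrow> 'a) set \<Rightarrow> ('i \<Rightarrow> 'a) set" where
  "upower_add U A B = upower_class U (\<lambda>i. upower_rep A i + upower_rep B i)"

definition upower_scale ::
  "'i filter \<Rightarrow> real \<Rightarrow> ('i \<Rightarrow> 'a::real_normed_vector) set \<Rightarrow> ('i \<Rightarrow> 'a) set" where
  "upower_scale U r A = upower_class U (\<lambda>i. r *\<^sub>R upower_rep A i)"

definition upower_norm :: "'i filter \<Rightarrow> ('i \<Rightarrow> 'a::real_normed_vector) set \<Rightarrow> real" where
  "upower_norm U A = Lim U (\<lambda>i. norm (upower_rep A i))"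

definition upower_dist ::
  "'i filter \<Rightarrow> ('i \<Rightarrow> 'a::real_normed_vector) set \<Rightarrow> ('i \<Rightarrow> 'a) set \<Rightarrow> real" where
  "upower_dist U A B = upower_norm U (upower_add U A (upower_scale U (-1) B))"

definition upower_set ::
  "'i filter \<Rightarrow> 'a::real_normed_vector set \<Rightarrow> ('i \<Rightarrow> 'a) set set" where
  "upower_set U A = {upower_class U f | f. f \<in> linfty \<and> (\<forall>i. f i \<in> A)}"

text \<open>The dual of the ultrapower; only the values on \<open>upower U\<close> matter.\<close>

definition upower_dual :: "'i filter \<Rightarrow> (('i \<Rightarrow> 'a::real_normed_vector) set \<Rightarrow> real) set" where
  "upower_dual U = {\<phi>.
     (\<forall>A\<in>upower U. \<forall>B\<in>upower U. \<phi> (upower_add U A B) = \<phi> A + \<phi> B) \<and>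
     (\<forall>r. \<forall>A\<in>upower U. \<phi> (upower_scale U r A) = r * \<phi> A) \<and>
     (\<exists>K. \<forall>A\<in>upower U. \<bar>\<phi> A\<bar> \<le> K * upower_norm U A)}"

text \<open>The functional on the ultrapower of \<open>X\<close> induced by an element of the ultrapower of the
  dual of \<open>X\<close>, and the subspace of \<open>upower_dual U\<close> formed by these functionals.\<close>

definition upower_functional ::
  "'i filter \<Rightarrow> ('i \<Rightarrow> ('a::real_normed_vector \<Rightarrow>\<^sub>L real)) set \<Rightarrow> ('i \<Rightarrow> 'a) set \<Rightarrow> real" where
  "upower_functional U F A = Lim U (\<lambda>i. blinfun_apply (upower_rep F i) (upower_rep A i))"

definition dual_upower :: "'i filter \<Rightarrow> (('i \<Rightarrow> 'a::real_normed_vector) set \<Rightarrow> real) set" where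
  "dual_upower U = upower_functional U ` upower U"

section \<open>Slices and denting points\<close>

definition slice :: "'y set \<Rightarrow> ('y \<Rightarrow> real) \<Rightarrow> real \<Rightarrow> 'y set" where
  "slice D \<phi> \<alpha> = {y \<in> D. \<phi> y > (SUP z\<in>D. \<phi> z) - \<alpha>}"

text \<open>The analogue of \<^const>\<open>diameter\<close> for an explicitly given distance function.\<close>

definition diam :: "('y \<Rightarrow> 'y \<Rightarrow> real) \<Rightarrow> 'y set \<Rightarrow> real" where
  "diam d S = (if S = {} then 0 else SUP (x, y)\<in>S \<times> S. d x y)"

definition denting_point ::
  "('y \<Rightarrow> 'y \<Rightarrow> real) \<Rightarrow> ('y \<Rightarrow> real) set \<Rightarrow> 'y set \<Rightarrow> 'y \<Rightarrow> bool" where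
  "denting_point d Z D y \<longleftrightarrow> y \<in> D \<and>
     (\<forall>\<epsilon>>0. \<exists>\<phi>\<in>Z. \<exists>\<alpha>>0. y \<in> slice D \<phi> \<alpha> \<and> diam d (slice D \<phi> \<alpha>) < \<epsilon>)"

definition uniformly_denting :: "'a::real_normed_vector set \<Rightarrow> ('i \<Rightarrow> 'a) \<Rightarrow> bool" where
  "uniformly_denting C x \<longleftrightarrow>
     (\<forall>\<epsilon>>0. \<exists>\<alpha>>0. \<forall>i. \<exists>\<phi> :: 'a \<Rightarrow>\<^sub>L real. norm \<phi> = 1 \<and>
        x i \<in> slice C (blinfun_apply \<phi>) \<alpha> \<and>
        diameter (slice C (blinfun_apply \<phi>) \<alpha>) < \<epsilon>)"

section \<open>Independence of representatives\<close>

lemma diam_dist: "diam dist S = diameter S"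
  by (simp add: diam_def diameter_def)

lemma linftyD: "f \<in> linfty \<Longrightarrow> \<exists>B. \<forall>i. norm (f i) \<le> B"
  unfolding linfty_def bounded_iff by auto

lemma linftyI: "(\<And>i. norm (f i) \<le> B) \<Longrightarrow> f \<in> linfty"
  unfolding linfty_def bounded_iff by auto

lemma linfty_add:
  assumes "f \<in> linfty" "g \<in> linfty"
  shows "(\<lambda>i. f i + g i) \<in> linfty"
proof -
  obtain B where B: "\<And>i. norm (f i) \<le> B" using linftyD[OF assms(1)] by blast
  obtain C where C: "\<And>i. norm (g i) \<le> C" using linftyD[OF assms(2)] by blast
  show ?thesis
    by (rule linftyI[of _ "B + C"]) (intro norm_triangle_le add_mono B C)
qed

lemma linfty_scale:
  assumes "f \<in> linfty"
  shows "(\<lambda>i. r *\<^sub>R f i) \<in> linfty"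
proof -
  obtain B where B: "\<And>i. norm (f i) \<le> B" using linftyD[OF assms] by blast
  show ?thesis
    by (rule linftyI[of _ "\<bar>r\<bar> * B"]) (simp add: B mult_left_mono)
qed

lemma ultrafilter_tendsto_Lim:
  fixes f :: "'i \<Rightarrow> real"
  assumes "ultrafilter U" "bounded (range f)"
  shows "(f \<longlongrightarrow> Lim U f) U"
proof -
  have U: "U \<noteq> bot" "\<And>P. eventually P U \<or> eventually (\<lambda>i. \<not> P i) U"
    using assms(1) by (auto simp: ultrafilter_def)
  have "compact (closure (range f))"
    using assms(2) by (simp add: compact_closure)
  moreover have "filtermap f U \<noteq> bot"
    using U(1) by (simp add: filtermap_bot_iff)
  moreover have "eventually (\<lambda>y. y \<in> closure (range f)) (filtermap f U)"
    by (auto simp: eventually_filtermap intro!: always_eventually subsetD[OF closure_subset])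
  ultimately obtain l where l: "inf (nhds l) (filtermap f U) \<noteq> bot"
    unfolding compact_filter by blast
  have "(f \<longlongrightarrow> l) U"
  proof (rule topological_tendstoI)
    fix S assume S: "open S" "l \<in> S"
    show "eventually (\<lambda>i. f i \<in> S) U"
    proof (rule ccontr)
      assume "\<not> ?thesis"
      then have *: "eventually (\<lambda>i. f i \<notin> S) U" using U(2) by blast
      have "eventually (\<lambda>_. False) (inf (nhds l) (filtermap f U))"
        unfolding eventually_inf
        by (rule exI[of _ "\<lambda>y. y \<in> S"], rule exI[of _ "\<lambda>y. y \<notin> S"])
           (use S * in \<open>auto simp: eventually_filtermap eventually_nhds\<close>)
      with l show False by (simp add: trivial_limit_def)
    qed
  qed
  then show ?thesis using tendsto_Lim U(1) by blast
qed

lemma equiv_upower_rel: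
  "equiv linfty (upower_rel U :: (('i \<Rightarrow> 'a::real_normed_vector) \<times> ('i \<Rightarrow> 'a)) set)"
    (is "equiv _ ?R")
proof (rule equivI)
  show "?R \<subseteq> linfty \<times> linfty" by (auto simp: upower_rel_def)
  show "refl_on linfty ?R" by (auto simp: refl_on_def upower_rel_def)
  show "sym ?R" by (auto simp: sym_def upower_rel_def norm_minus_commute)
  show "trans ?R"
  proof (rule transI)
    fix f g h
    assume "(f, g) \<in> ?R" "(g, h) \<in> ?R"
    then have *: "((\<lambda>i. f i - g i) \<longlongrightarrow> 0) U" "((\<lambda>i. g i - h i) \<longlongrightarrow> 0) U"
      and fh: "f \<in> linfty" "h \<in> linfty"
      by (auto simp: upower_rel_def tendsto_norm_zero_iff)
    have "((\<lambda>i. f i - h i) \<longlongrightarrow> 0) U"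
      using tendsto_add[OF *] by simp
    then show "(f, h) \<in> ?R"
      using fh by (simp add: upower_rel_def tendsto_norm_zero_iff)
  qed
qed

lemma upower_class_in: "f \<in> linfty \<Longrightarrow> upower_class U f \<in> upower U"
  by (simp add: upower_def upower_class_def quotientI)

lemma upower_class_eq_iff:
  "f \<in> linfty \<Longrightarrow> g \<in> linfty \<Longrightarrow>
     upower_class U f = upower_class U g \<longleftrightarrow> ((\<lambda>i. norm (f i - g i)) \<longlongrightarrow> 0) U"
  using eq_equiv_class_iff[OF equiv_upower_rel, of f g U]
  by (simp add: upower_class_def upower_rel_def)

lemma upower_rep:
  assumes "A \<in> upower U"
  shows "upower_rep A \<in> linfty" "upower_class U (upower_rep A) = A"
proof -
  obtain f where f: "f \<in> linfty" "A = upower_class U f"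
    using assms unfolding upower_def upower_class_def by (rule quotientE)
  have "f \<in> A"
    using f by (simp add: upower_class_def upower_rel_def)
  then have "upower_rep A \<in> A"
    unfolding upower_rep_def by (rule someI[of "\<lambda>f. f \<in> A"])
  then have r: "(f, upower_rep A) \<in> upower_rel U"
    by (simp add: f(2) upower_class_def)
  then show "upower_rep A \<in> linfty"
    by (simp add: upower_rel_def)
  show "upower_class U (upower_rep A) = A"
    using equiv_class_eq[OF equiv_upower_rel r] by (simp add: f(2) upower_class_def)
qed

lemma upower_cases:
  assumes "A \<in> upower U"
  obtains f where "f \<in> linfty" "A = upower_class U f"
  using upower_rep[OF assms] that[of "upower_rep A"] by simp

lemma upower_rep_class:
  assumes "f \<in> linfty"
  shows "upower_rep (upower_class U f) \<in> linfty"
    "((\<lambda>i. upower_rep (upower_class U f) i - f i) \<longlongrightarrow> 0) U"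
  using upower_rep[OF upower_class_in[OF assms, of U]] upower_class_eq_iff assms
  by (auto simp: tendsto_norm_zero_iff)

lemma upower_norm_class:
  fixes f :: "'i \<Rightarrow> 'a::real_normed_vector"
  assumes "ultrafilter U" "f \<in> linfty"
  shows "((\<lambda>i. norm (f i)) \<longlongrightarrow> upower_norm U (upower_class U f)) U"
proof -
  let ?r = "upower_rep (upower_class U f)"
  have "bounded (range (\<lambda>i. norm (?r i)))"
    using upower_rep_class(1)[OF assms(2), of U] by (auto simp: linfty_def bounded_iff)
  then have 1: "((\<lambda>i. norm (?r i)) \<longlongrightarrow> upower_norm U (upower_class U f)) U"
    unfolding upower_norm_def by (rule ultrafilter_tendsto_Lim[OF assms(1)])
  have "((\<lambda>i. norm (?r i) - norm (f i)) \<longlongrightarrow> 0) U"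
    by (rule Lim_null_comparison[OF _ tendsto_norm_zero[OF upower_rep_class(2)[OF assms(2)]]])
       (auto intro!: always_eventually norm_triangle_ineq3)
  from tendsto_diff[OF 1 this] show ?thesis by simp
qed

lemma upower_add_class:
  assumes "f \<in> linfty" "g \<in> linfty"
  shows "upower_add U (upower_class U f) (upower_class U g) = upower_class U (\<lambda>i. f i + g i)"
  unfolding upower_add_def
  using tendsto_add[OF upower_rep_class(2)[OF assms(1)] upower_rep_class(2)[OF assms(2)], of U]
  by (subst upower_class_eq_iff)
     (auto intro!: linfty_add assms upower_rep_class(1) simp: tendsto_norm_zero_iff algebra_simps)

lemma upower_scale_class:
  assumes "f \<in> linfty"
  shows "upower_scale U r (upower_class U f) = upower_class U (\<lambda>i. r *\<^sub>R f i)"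
  unfolding upower_scale_def
  using tendsto_scaleR[OF tendsto_const upower_rep_class(2)[OF assms(1)], of r U]
  by (subst upower_class_eq_iff)
     (auto intro!: linfty_scale assms upower_rep_class(1) simp: tendsto_norm_zero_iff algebra_simps)

lemma upower_dist_class:
  assumes "ultrafilter U" "f \<in> linfty" "g \<in> linfty"
  shows "((\<lambda>i. dist (f i) (g i)) \<longlongrightarrow> upower_dist U (upower_class U f) (upower_class U g)) U"
  using upower_norm_class[OF assms(1) linfty_add[OF assms(2) linfty_scale[OF assms(3), of "-1"]]]
  unfolding upower_dist_def upower_scale_class[OF assms(3)]
    upower_add_class[OF assms(2) linfty_scale[OF assms(3)]]
  by (simp add: dist_norm)

lemma upower_functional_class:
  fixes \<phi> :: "'i \<Rightarrow> 'a::real_normed_vector \<Rightarrow>\<^sub>L real"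
  assumes U: "ultrafilter U" and \<phi>: "\<phi> \<in> linfty" and f: "f \<in> linfty"
  shows "((\<lambda>i. blinfun_apply (\<phi> i) (f i)) \<longlongrightarrow>
           upower_functional U (upower_class U \<phi>) (upower_class U f)) U"
proof -
  let ?p = "upower_rep (upower_class U \<phi>)" and ?r = "upower_rep (upower_class U f)"
  note p = upower_rep_class[OF \<phi>, of U] and r = upower_rep_class[OF f, of U]
  obtain P where P: "\<And>i. norm (?p i) \<le> P" using linftyD[OF p(1)] by blast
  obtain R where R: "\<And>i. norm (?r i) \<le> R" using linftyD[OF r(1)] by blast
  obtain Q where Q: "\<And>i. norm (\<phi> i) \<le> Q" using linftyD[OF \<phi>] by blast
  have "norm (blinfun_apply (?p i) (?r i)) \<le> P * R" for i
    by (rule order_trans[OF norm_blinfun])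
       (intro mult_mono P R norm_ge_zero order_trans[OF norm_ge_zero P])
  then have "bounded (range (\<lambda>i. blinfun_apply (?p i) (?r i)))"
    unfolding bounded_iff by blast
  then have 1: "((\<lambda>i. blinfun_apply (?p i) (?r i)) \<longlongrightarrow>
      upower_functional U (upower_class U \<phi>) (upower_class U f)) U"
    unfolding upower_functional_def by (rule ultrafilter_tendsto_Lim[OF U])
  have "norm (blinfun_apply (?p i) (?r i) - blinfun_apply (\<phi> i) (f i))
      \<le> norm (?p i - \<phi> i) * R + Q * norm (?r i - f i)" for i
  proof -
    have "blinfun_apply (?p i) (?r i) - blinfun_apply (\<phi> i) (f i)
        = blinfun_apply (?p i - \<phi> i) (?r i) + blinfun_apply (\<phi> i) (?r i - f i)"
      by (simp add: blinfun.diff_left blinfun.diff_right)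
    also have "norm \<dots> \<le> norm (?p i - \<phi> i) * norm (?r i) + norm (\<phi> i) * norm (?r i - f i)"
      by (intro norm_triangle_le add_mono norm_blinfun)
    also have "\<dots> \<le> norm (?p i - \<phi> i) * R + Q * norm (?r i - f i)"
      by (intro add_mono mult_left_mono mult_right_mono R Q norm_ge_zero)
    finally show ?thesis .
  qed
  moreover have "((\<lambda>i. norm (?p i - \<phi> i) * R + Q * norm (?r i - f i)) \<longlongrightarrow> 0) U"
    using tendsto_add[OF tendsto_mult_right[OF tendsto_norm_zero[OF p(2)], of R]
        tendsto_mult_left[OF tendsto_norm_zero[OF r(2)], of Q]] by simp
  ultimately have "((\<lambda>i. blinfun_apply (?p i) (?r i) - blinfun_apply (\<phi> i) (f i)) \<longlongrightarrow> 0) U"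
    by (rule Lim_null_comparison[OF always_eventually[OF allI]])
  from tendsto_diff[OF 1 this] show ?thesis by simp
qed

lemma dual_upower_subset:
  assumes U: "ultrafilter U"
  shows "dual_upower U \<subseteq> (upower_dual U :: (('i \<Rightarrow> 'a::real_normed_vector) set \<Rightarrow> real) set)"
proof
  fix \<psi> :: "('i \<Rightarrow> 'a) set \<Rightarrow> real"
  assume "\<psi> \<in> dual_upower U"
  then obtain \<phi> :: "'i \<Rightarrow> 'a \<Rightarrow>\<^sub>L real" where \<phi>: "\<phi> \<in> linfty"
    and \<psi>: "\<psi> = upower_functional U (upower_class U \<phi>)"
    unfolding dual_upower_def by (auto elim: upower_cases)
  have nb: "U \<noteq> bot" using U by (simp add: ultrafilter_def)
  have lim: "((\<lambda>i. blinfun_apply (\<phi> i) (f i)) \<longlongrightarrow> \<psi> (upower_class U f)) U" if "f \<in> linfty" for f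
    unfolding \<psi> by (rule upower_functional_class[OF U \<phi> that])
  have add: "\<psi> (upower_add U A B) = \<psi> A + \<psi> B" if A: "A \<in> upower U" "B \<in> upower U" for A B
  proof -
    obtain f where f: "f \<in> linfty" "A = upower_class U f" using A(1) by (rule upower_cases)
    obtain g where g: "g \<in> linfty" "B = upower_class U g" using A(2) by (rule upower_cases)
    show ?thesis
      using tendsto_unique[OF nb lim[OF linfty_add[OF f(1) g(1)]]]
        tendsto_add[OF lim[OF f(1)] lim[OF g(1)]]
      unfolding f(2) g(2) upower_add_class[OF f(1) g(1)] blinfun.add_right by blast
  qed
  have scale: "\<psi> (upower_scale U r A) = r * \<psi> A" if A: "A \<in> upower U" for r A
  proof -
    obtain f where f: "f \<in> linfty" "A = upower_class U f" using A by (rule upower_cases)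
    show ?thesis
      using tendsto_unique[OF nb lim[OF linfty_scale[OF f(1), of r]]]
        tendsto_mult_left[OF lim[OF f(1)], of r]
      unfolding f(2) upower_scale_class[OF f(1)] blinfun.scaleR_right real_scaleR_def by blast
  qed
  have bnd: "\<bar>\<psi> A\<bar> \<le> upower_norm U (upower_class U \<phi>) * upower_norm U A" if A: "A \<in> upower U" for A
  proof -
    obtain f where f: "f \<in> linfty" "A = upower_class U f" using A by (rule upower_cases)
    show ?thesis unfolding f(2)
      by (rule tendsto_le[OF nb tendsto_mult[OF upower_norm_class[OF U \<phi>] upower_norm_class[OF U f(1)]]
            tendsto_rabs[OF lim[OF f(1)]]])
         (intro always_eventually allI norm_blinfun[of "\<phi> _" "f _", unfolded real_norm_def])
  qed
  show "\<psi> \<in> upower_dual U"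
    unfolding upower_dual_def using add scale bnd by blast
qed

end

theory Submission
  imports Defs
begin

text \<open>Let \<open>M\<^sub>i\<close> be the supremum of the \<open>i\<close>-th functional on \<open>C\<close>. From \<open>\<phi>\<^sub>i(x\<^sub>i) > M\<^sub>i - \<alpha>\<close> one only
  gets the weak inequality \<open>\<ge>\<close> in the limit, so the class of \<open>x\<close> may miss the slice of width \<open>\<alpha>\<close>
  of the ultrapower. By convexity, however, doubling the width of a slice at most doubles its
  diameter; hence the slices of width \<open>2\<alpha>\<close>, which contain the \<open>x\<^sub>i\<close> with the uniform margin \<open>\<alpha>\<close>,
  are still small, and the inequalities pass to the ultrapower.\<close>

text \<open>Average both points with one common \<open>z\<close> in \<open>C\<close> at which the
  functional is close to its supremum. Convexity keeps the midpoints in \<open>C\<close>, the large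
  value at \<open>z\<close> lifts them into the narrow slice, and averaging halves the
  distance.\<close>

lemma dist_slice_double_le:
  fixes C :: "'a::real_normed_vector set" and \<phi> :: "'a \<Rightarrow>\<^sub>L real"
  assumes "bounded C" "convex C"
    and y: "y \<in> slice C \<phi> (2 * \<alpha>)" and y': "y' \<in> slice C \<phi> (2 * \<alpha>)"
  shows "dist y y' \<le> 2 * diameter (slice C \<phi> \<alpha>)"
proof -
  let ?M = "SUP z\<in>C. \<phi> z"
  have C: "y \<in> C" "y' \<in> C" and gt: "\<phi> y > ?M - 2 * \<alpha>" "\<phi> y' > ?M - 2 * \<alpha>"
    using y y' by (auto simp: slice_def)
  have "bounded (\<phi> ` C)"
    using assms(1) by (simp add: bounded_linear_image blinfun.bounded_linear_right)
  then have "bdd_above (\<phi> ` C)" by (rule bounded_imp_bdd_above)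
  \<comment> \<open>\<open>midpoint w z\<close> has value above \<open>?M - \<alpha>\<close> exactly
    when \<open>\<phi> z > 2 * ?M - 2 * \<alpha> - \<phi> w\<close>. This threshold is below
    \<open>?M\<close> because \<open>w\<close> lies in the wide slice; the maximum makes one
    \<open>z\<close> serve both points.\<close>
  moreover have "max (2 * ?M - 2 * \<alpha> - \<phi> y) (2 * ?M - 2 * \<alpha> - \<phi> y') < ?M" (is "?m < _")
    using gt by simp
  ultimately have "\<exists>z\<in>C. ?m < \<phi> z"
    using C(1) by (subst (asm) less_cSUP_iff) auto
  then obtain z where z: "z \<in> C"
    and zM: "\<phi> z > 2 * ?M - 2 * \<alpha> - \<phi> y" "\<phi> z > 2 * ?M - 2 * \<alpha> - \<phi> y'"
    by (auto simp only: max_less_iff_conj)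
  have mid: "midpoint w z \<in> slice C \<phi> \<alpha>" if "w \<in> C" "\<phi> z > 2 * ?M - 2 * \<alpha> - \<phi> w" for w
  proof -
    have "midpoint w z \<in> C"
      using convexD_alt[OF assms(2) that(1) z, of "1/2"]
      by (simp add: midpoint_def scaleR_add_right)
    then show ?thesis
      using that(2) by (simp add: slice_def midpoint_def blinfun.scaleR_right blinfun.add_right)
  qed
  have "bounded (slice C \<phi> \<alpha>)"
    using assms(1) by (rule bounded_subset) (auto simp: slice_def)
  then have "dist (midpoint y z) (midpoint y' z) \<le> diameter (slice C \<phi> \<alpha>)"
    by (rule diameter_bounded_bound[OF _ mid[OF C(1) zM(1)] mid[OF C(2) zM(2)]])
  moreover have "midpoint y z - midpoint y' z = (1/2) *\<^sub>R (y - y')"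
    by (simp add: midpoint_def algebra_simps)
  then have "dist (midpoint y z) (midpoint y' z) = dist y y' / 2"
    by (simp add: dist_norm)
  ultimately show ?thesis by simp
qed

lemma bounded_range_in_linfty: "bounded C \<Longrightarrow> (\<And>i. f i \<in> C) \<Longrightarrow> f \<in> linfty"
  by (auto simp: linfty_def intro: bounded_subset)

text \<open>The upper bound holds coordinatewise and passes to the limit. For the lower bound,
  near-maximizers chosen in every coordinate with the same error form an element of the ultrapower
  set.\<close>

lemma upower_functional_SUP:
  fixes C :: "'a::real_normed_vector set" and \<phi> :: "'i \<Rightarrow> 'a \<Rightarrow>\<^sub>L real"
  assumes U: "ultrafilter U" and C: "bounded C" "C \<noteq> {}" and \<phi>: "\<phi> \<in> linfty"
  shows "((\<lambda>i. SUP z\<in>C. \<phi> i z) \<longlongrightarrow>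
           (SUP A\<in>upower_set U C. upower_functional U (upower_class U \<phi>) A)) U"
proof -
  let ?M = "\<lambda>i. SUP z\<in>C. \<phi> i z" and ?\<Phi> = "upower_functional U (upower_class U \<phi>)"
  have nb: "U \<noteq> bot" using U by (simp add: ultrafilter_def)
  obtain B where B: "\<And>z. z \<in> C \<Longrightarrow> norm z \<le> B" using C(1) by (auto simp: bounded_iff)
  obtain K where K: "\<And>i. norm (\<phi> i) \<le> K" using linftyD[OF \<phi>] by blast
  have bnd: "\<bar>\<phi> i z\<bar> \<le> K * B" if "z \<in> C" for i z
    using norm_blinfun[of "\<phi> i" z]
      mult_mono[OF K B[OF that] order_trans[OF norm_ge_zero K[of i]] norm_ge_zero, of i]
    unfolding real_norm_def by (rule order_trans)
  then have bdd: "bdd_above (blinfun_apply (\<phi> i) ` C)" for i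
    by (auto simp: bdd_above_def abs_le_iff intro!: exI[of _ "K * B"])
  \<comment> \<open>The bound \<open>K * B\<close> is independent of \<open>i\<close>, so the
    suprema form a bounded family and \<open>Lim U ?M\<close> is a genuine limit.\<close>
  have "\<bar>?M i\<bar> \<le> K * B" for i
  proof (rule cSup_abs_le)
    show "blinfun_apply (\<phi> i) ` C \<noteq> {}" using C(2) by blast
    show "\<bar>r\<bar> \<le> K * B" if "r \<in> blinfun_apply (\<phi> i) ` C" for r
      using that by (elim imageE) (simp only: bnd)
  qed
  then have "bounded (range ?M)" by (auto simp: bounded_iff)
  then have lim: "(?M \<longlongrightarrow> Lim U ?M) U" by (rule ultrafilter_tendsto_Lim[OF U])
  have le: "?\<Phi> A \<le> Lim U ?M" if "A \<in> upower_set U C" for A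
  proof -
    obtain f where f: "f \<in> linfty" "\<And>i. f i \<in> C" "A = upower_class U f"
      using \<open>A \<in> upower_set U C\<close> by (auto simp: upower_set_def)
    show ?thesis unfolding f(3)
      by (rule tendsto_le[OF nb lim upower_functional_class[OF U \<phi> f(1)]])
         (auto intro!: always_eventually cSUP_upper bdd f)
  qed
  have approx: "\<exists>A\<in>upower_set U C. Lim U ?M - \<eta> \<le> ?\<Phi> A" if "\<eta> > 0" for \<eta>
  proof -
    \<comment> \<open>One \<open>\<eta>\<close> for all coordinates lets the error survive the limit
      unchanged; boundedness of \<open>C\<close> puts the chosen points in
      \<open>linfty\<close>.\<close>
    have "\<exists>z\<in>C. ?M i - \<eta> < \<phi> i z" for i
      using less_cSUP_iff[OF C(2) bdd, of "?M i - \<eta>" i] \<open>\<eta> > 0\<close> by simp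
    then obtain f where f: "\<And>i. f i \<in> C" "\<And>i. ?M i - \<eta> < \<phi> i (f i)" by metis
    then have "f \<in> linfty" using C(1) by (blast intro: bounded_range_in_linfty)
    then have "Lim U ?M - \<eta> \<le> ?\<Phi> (upower_class U f)"
      by (intro tendsto_le[OF nb upower_functional_class[OF U \<phi>] tendsto_diff[OF lim tendsto_const]])
         (auto intro!: always_eventually less_imp_le f)
    then show ?thesis using \<open>f \<in> linfty\<close> f(1) by (auto simp: upower_set_def)
  qed
  have ne: "upower_set U C \<noteq> {}" using approx[of 1] by auto
  have "bdd_above (?\<Phi> ` upower_set U C)" using le by (auto simp: bdd_above_def)
  then have "Lim U ?M - \<eta> \<le> Sup (?\<Phi> ` upower_set U C)" if "\<eta> > 0" for \<eta>
    using approx[OF that] by (elim bexE) (rule cSUP_upper2)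
  then have "Lim U ?M \<le> Sup (?\<Phi> ` upower_set U C)"
    unfolding diff_le_eq by (rule field_le_epsilon)
  moreover have "Sup (?\<Phi> ` upower_set U C) \<le> Lim U ?M"
    by (rule cSUP_least[OF ne le])
  ultimately have "Lim U ?M = Sup (?\<Phi> ` upower_set U C)" by (rule order_antisym)
  with lim show ?thesis by (simp only:)
qed

theorem theorem3p13:
  fixes C :: "'a::banach set" and U :: "'i filter" and x :: "'i \<Rightarrow> 'a"
  assumes "bounded C" and "convex C"
    and "infinite (UNIV :: 'i set)" and "free_ultrafilter U"
    and "\<forall>i. x i \<in> C" and "uniformly_denting C x"
  shows "denting_point (upower_dist U) (dual_upower U) (upower_set U C) (upower_class U x)"
proof -
  have U: "ultrafilter U" using assms(4) by (simp add: free_ultrafilter_def)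
  then have nb: "U \<noteq> bot" by (simp add: ultrafilter_def)
  have x: "x \<in> linfty" using assms(1,5) by (blast intro: bounded_range_in_linfty)
  then have xC: "upower_class U x \<in> upower_set U C"
    using assms(5) by (auto simp: upower_set_def)
  have "\<exists>\<Phi>\<in>dual_upower U. \<exists>\<beta>>0. upower_class U x \<in> slice (upower_set U C) \<Phi> \<beta> \<and>
          diam (upower_dist U) (slice (upower_set U C) \<Phi> \<beta>) < \<epsilon>" if "\<epsilon> > 0" for \<epsilon> :: real
  proof -
    \<comment> \<open>Doubling the width costs a factor 2, and the limit preserves only weak
      inequalities; \<open>2 * (\<epsilon> / 3)\<close> is still strictly below
      \<open>\<epsilon>\<close>.\<close>
    have "\<epsilon> / 3 > 0" using that by simp
    then obtain \<alpha> where \<alpha>: "\<alpha> > 0" and ex: "\<forall>i. \<exists>\<phi> :: 'a \<Rightarrow>\<^sub>L real. norm \<phi> = 1 \<and>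
        x i \<in> slice C (blinfun_apply \<phi>) \<alpha> \<and> diameter (slice C (blinfun_apply \<phi>) \<alpha>) < \<epsilon> / 3"
      using assms(6) unfolding uniformly_denting_def by blast
    from choice[OF ex] obtain \<phi> :: "'i \<Rightarrow> 'a \<Rightarrow>\<^sub>L real" where norm: "\<And>i. norm (\<phi> i) = 1"
      and xs: "\<And>i. x i \<in> slice C (\<phi> i) \<alpha>"
      and small: "\<And>i. diameter (slice C (\<phi> i) \<alpha>) < \<epsilon> / 3"
      by blast
    \<comment> \<open>The normalization bounds the family of functionals, so it defines an element
      of the ultrapower of the dual.\<close>
    have \<phi>: "\<phi> \<in> linfty" by (rule linftyI[of _ 1]) (simp add: norm)
    define \<Phi> where "\<Phi> = upower_functional U (upower_class U \<phi>)"
    let ?M = "\<lambda>i. SUP z\<in>C. \<phi> i z" and ?S = "slice (upower_set U C) \<Phi> (2 * \<alpha>)"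
    have "\<Phi> \<in> dual_upower U"
      unfolding \<Phi>_def dual_upower_def by (intro imageI upower_class_in \<phi>)
    have lim: "((\<lambda>i. \<phi> i (f i)) \<longlongrightarrow> \<Phi> (upower_class U f)) U" if "f \<in> linfty" for f
      unfolding \<Phi>_def by (rule upower_functional_class[OF U \<phi> that])
    have limM: "(?M \<longlongrightarrow> (SUP A\<in>upower_set U C. \<Phi> A)) U"
      unfolding \<Phi>_def using assms(5) by (intro upower_functional_SUP U assms(1) \<phi>) auto
    have "(SUP A\<in>upower_set U C. \<Phi> A) - \<alpha> \<le> \<Phi> (upower_class U x)"
      by (rule tendsto_le[OF nb lim[OF x] tendsto_diff[OF limM tendsto_const]])
         (use xs in \<open>auto intro!: always_eventually less_imp_le simp: slice_def\<close>)
    then have mem: "upower_class U x \<in> ?S" using \<alpha> xC by (simp add: slice_def)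
    have "upower_dist U A B \<le> 2 * (\<epsilon> / 3)" if AB: "A \<in> ?S" "B \<in> ?S" for A B
    proof -
      have rep: "\<exists>f\<in>linfty. D = upower_class U f \<and> (\<forall>\<^sub>F i in U. f i \<in> slice C (\<phi> i) (2 * \<alpha>))"
        if D: "D \<in> ?S" for D
      proof -
        \<comment> \<open>This representative has all its values in \<open>C\<close>; an arbitrary
          one, such as \<open>upower_rep D\<close>, may leave \<open>C\<close>.\<close>
        obtain f where f: "f \<in> linfty" "\<And>i. f i \<in> C" "D = upower_class U f"
          using D by (auto simp: slice_def upower_set_def)
        \<comment> \<open>A strict inequality between limits holds in \<open>U\<close>-almost every
          coordinate, which suffices to bound the limit of the distances.\<close>
        have "0 < \<Phi> D - ((SUP A\<in>upower_set U C. \<Phi> A) - 2 * \<alpha>)"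
          using D by (simp add: slice_def)
        then have "\<forall>\<^sub>F i in U. 0 < \<phi> i (f i) - (?M i - 2 * \<alpha>)"
          unfolding f(3)
          by (rule order_tendstoD(1)[OF tendsto_diff[OF lim[OF f(1)]
                tendsto_diff[OF limM tendsto_const]]])
        then show ?thesis
          using f by (auto simp: slice_def elim!: eventually_mono intro!: bexI[of _ f])
      qed
      obtain f where f: "f \<in> linfty" "A = upower_class U f"
        and fS: "\<forall>\<^sub>F i in U. f i \<in> slice C (\<phi> i) (2 * \<alpha>)" using rep[OF AB(1)] by blast
      obtain g where g: "g \<in> linfty" "B = upower_class U g"
        and gS: "\<forall>\<^sub>F i in U. g i \<in> slice C (\<phi> i) (2 * \<alpha>)" using rep[OF AB(2)] by blast
      have "\<forall>\<^sub>F i in U. dist (f i) (g i) \<le> 2 * (\<epsilon> / 3)"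
        using fS gS
      proof eventually_elim
        case (elim i)
        show ?case
          using dist_slice_double_le[OF assms(1,2) elim] small[of i] by simp
      qed
      then show ?thesis
        unfolding f(2) g(2)
        by (rule tendsto_upperbound[OF upower_dist_class[OF U f(1) g(1)] _ nb])
    qed
    \<comment> \<open>The class of \<open>x\<close> makes the slice nonempty: this is needed to
      bound the real supremum and excludes the default value 0 of \<open>diam\<close>.\<close>
    then have "(SUP (A, B)\<in>?S \<times> ?S. upower_dist U A B) \<le> 2 * (\<epsilon> / 3)"
      by (intro cSUP_least) (use mem in \<open>blast, elim SigmaE, simp\<close>)
    moreover have "?S \<noteq> {}" using mem by blast
    ultimately have "diam (upower_dist U) ?S \<le> 2 * (\<epsilon> / 3)"
      by (simp only: diam_def if_False)
    also have "\<dots> < \<epsilon>" using \<open>\<epsilon> > 0\<close> by simp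
    finally show ?thesis
      using \<open>\<Phi> \<in> dual_upower U\<close> mem \<alpha> by (intro bexI[of _ \<Phi>] exI[of _ "2 * \<alpha>"]) auto
  qed
  then show ?thesis unfolding denting_point_def using xC by blast
qed

end
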